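(* The following hold: (i) The set $\{\theta\in\mathbb{R}^d:(\forall\,(k,i)\in\Lambda:\|V^{k,\theta}_i\|=1)\}$ is a $\bigl(d-\sum_{k=1}^{L-1}\ell_k\bigr)$-dimensional $C^\infty$-submanifold of $\mathbb{R}^d$. (ii) For all $\theta\in\mathbb{R}^d$ it holds that $\mathcal{N}^{L,\theta}_\infty=\mathcal{N}^{L,\Psi_{L-1}(\theta)}_\infty$. (iii) For all $\theta\in\{\vartheta\in\mathbb{R}^d:\min_{(k,i)\in\Lambda}\|V^{k,\vartheta}_i\|>0\}$ and all $(k,i)\in\Lambda$ it holds that $\|V^{k,\Psi_{L-1}(\theta)}_i\|=1$.
   Context: Let $a\in\mathbb{R}$, $b\in(a,\infty)$, $L\in\{2,3,\dots\}$, $\ell_0,\ell_1,\dots,\ell_L\in\mathbb{N}=\{1,2,\dots\}$, and $d=\sum_{k=1}^L\ell_k(\ell_{k-1}+1)$. Norms are Euclidean. For every $\theta=(\theta_1,\dots,\theta_d)\in\mathbb{R}^d$ and $k\in\{1,\dots,L\}$ let $w^{k,\theta}=(w^{k,\theta}_{i,j})\in\mathbb{R}^{\ell_k\times\ell_{k-1}}$ and $b^{k,\theta}=(b^{k,\theta}_1,\dots,b^{k,\theta}_{\ell_k})\in\mathbb{R}^{\ell_k}$ be given for $i\in\{1,\dots,\ell_k\}$, $j\in\{1,\dots,\ell_{k-1}\}$ by $$w^{k,\theta}_{i,j}=\theta_{(i-1)\ell_{k-1}+j+\sum_{h=1}^{k-1}\ell_h(\ell_{h-1}+1)},\qquad b^{k,\theta}_i=\theta_{\ell_k\ell_{k-1}+i+\sum_{h=1}^{k-1}\ell_h(\ell_{h-1}+1)},$$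 and let $A^\theta_k(x)=b^{k,\theta}+w^{k,\theta}x$ for $x\in\mathbb{R}^{\ell_{k-1}}$. Let $\mathfrak{M}^k_\infty\colon\mathbb{R}^{\ell_k}\to\mathbb{R}^{\ell_k}$, $\mathfrak{M}^k_\infty(x_1,\dots,x_{\ell_k})=(\max\{x_1,0\},\dots,\max\{x_{\ell_k},0\})$. Let $\mu$ be a finite measure on the Borel sets of $[a,b]^{\ell_0}$. For $\theta\in\mathbb{R}^d$ define $\mathcal{N}^{k,\theta}_\infty\colon\mathbb{R}^{\ell_0}\to\mathbb{R}^{\ell_k}$, $k\in\{1,\dots,L\}$, by $\mathcal{N}^{1,\theta}_\infty(x)=A^\theta_1(x)$ and, for $k\in\{1,\dots,L-1\}$, $$\mathcal{N}^{k+1,\theta}_\infty(x)=A^\theta_{k+1}\Bigl((\mathfrak{M}^k_\infty\circ\mathcal{N}^{k,\theta}_\infty)(x)-\mathbb{1}_{\{L\}}(k+1)\int_{[a,b]^{\ell_0}}(\mathfrak{M}^k_\infty\circ\mathcal{N}^{k,\theta}_\infty)(y)\,\mu(\mathrm{d}y)\Bigr).$$ For $k\in\{1,\dots,L\}$, $i\in\{1,\dots,\ell_k\}$, $\theta\in\mathbb{R}^d$ let $V^{k,\theta}_i=(w^{k,\theta}_{i,1},\dots,w^{k,\theta}_{i,\ell_{k-1}},b^{k,\theta}_i)\in\mathbb{R}^{\ell_{k-1}+1}$. Let $\Lambda=\bigcup_{k=1}^{L-1}(\{k\}\times\{1,2,\dots,\ell_k\})$. For $n\in\mathbb{N}$,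 $x\in\mathbb{R}^n$ let $\rho(x)=[\|x\|+\mathbb{1}_{\{0\}}(\|x\|)]^{-1}x\in\mathbb{R}^n$. Define $\Psi_k\colon\mathbb{R}^d\to\mathbb{R}^d$, $k\in\{0,1,\dots,L-1\}$, recursively by $\Psi_0(\theta)=\theta$ and, for $k\in\{1,\dots,L-1\}$, $K\in\{1,\dots,L\}$, $i\in\{1,\dots,\ell_K\}$, $\theta\in\mathbb{R}^d$, $$V^{K,\Psi_k(\theta)}_i=\begin{cases}\rho(V^{K,\Psi_{k-1}(\theta)}_i)&: K=k\\ \operatorname{diag}\bigl(\|V^{k,\Psi_{k-1}(\theta)}_1\|,\dots,\|V^{k,\Psi_{k-1}(\theta)}_{\ell_k}\|,1\bigr)V^{K,\Psi_{k-1}(\theta)}_i&: K=k+1\\ V^{K,\Psi_{k-1}(\theta)}_i&: K\notin\{k,k+1\}.\end{cases}$$ *)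

theory Defs
  imports "HOL-Analysis.Analysis"
begin

text \<open>
  Vectors are those of \<^const>\<open>Euclidean_space\<close>: a point of R^n is a function on the natural
  numbers vanishing at all indices \<open>\<ge> n\<close>. Components, rows and columns are thus numbered from 0
  (the component usually written x_i is \<open>x (i - 1)\<close>), whereas layers keep their numbers 1, ..., L.
\<close>

abbreviation Rn :: "nat \<Rightarrow> (nat \<Rightarrow> real) set" where
  "Rn n \<equiv> topspace (Euclidean_space n)"

abbreviation enorm :: "nat \<Rightarrow> (nat \<Rightarrow> real) \<Rightarrow> real" where
  "enorm n x \<equiv> L2_set x {..<n}"


section \<open>Smooth submanifolds of R^n\<close>

definition partial_deriv :: "nat \<Rightarrow> ((nat \<Rightarrow> real) \<Rightarrow> real) \<Rightarrow> (nat \<Rightarrow> real) \<Rightarrow> real" where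
  "partial_deriv i f x = deriv (\<lambda>t. f (x(i := t))) (x i)"

text \<open>All iterated partial derivatives up to order \<open>k\<close> exist and are continuous on the (open) set
  \<open>U\<close> in R^n.\<close>

primrec Ck_on :: "nat \<Rightarrow> nat \<Rightarrow> (nat \<Rightarrow> real) set \<Rightarrow> ((nat \<Rightarrow> real) \<Rightarrow> real) \<Rightarrow> bool" where
  "Ck_on 0 n U f \<longleftrightarrow> continuous_map (subtopology (Euclidean_space n) U) euclideanreal f"
| "Ck_on (Suc k) n U f \<longleftrightarrow>
     continuous_map (subtopology (Euclidean_space n) U) euclideanreal f \<and>
     (\<forall>i<n. (\<forall>x\<in>U. (\<lambda>t. f (x(i := t))) differentiable at (x i)) \<and>
            Ck_on k n U (partial_deriv i f))"

definition smooth_map_on ::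
    "nat \<Rightarrow> (nat \<Rightarrow> real) set \<Rightarrow> nat \<Rightarrow> ((nat \<Rightarrow> real) \<Rightarrow> nat \<Rightarrow> real) \<Rightarrow> bool" where
  "smooth_map_on n U m f \<longleftrightarrow> f ` U \<subseteq> Rn m \<and> (\<forall>k. \<forall>j<m. Ck_on k n U (\<lambda>x. f x j))"

definition smooth_diffeo ::
    "nat \<Rightarrow> (nat \<Rightarrow> real) set \<Rightarrow> (nat \<Rightarrow> real) set \<Rightarrow> ((nat \<Rightarrow> real) \<Rightarrow> nat \<Rightarrow> real) \<Rightarrow> bool" where
  "smooth_diffeo n U V \<phi> \<longleftrightarrow>
     openin (Euclidean_space n) U \<and> openin (Euclidean_space n) V \<and> bij_betw \<phi> U V \<and>
     smooth_map_on n U n \<phi> \<and> smooth_map_on n V n (inv_into U \<phi>)"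

text \<open>Since \<open>Rn m\<close> is the set of points of \<open>Rn n\<close> whose last \<open>n - m\<close> components vanish, it
  is the linear slice (R^m times zero) in the usual definition.\<close>

definition smooth_submanifold :: "nat \<Rightarrow> nat \<Rightarrow> (nat \<Rightarrow> real) set \<Rightarrow> bool" where
  "smooth_submanifold n m M \<longleftrightarrow>
     m \<le> n \<and> M \<subseteq> Rn n \<and>
     (\<forall>p\<in>M. \<exists>U V \<phi>. p \<in> U \<and> smooth_diffeo n U V \<phi> \<and> \<phi> ` (U \<inter> M) = V \<inter> Rn m)"


section \<open>Borel measures on cubes\<close>

definition cube :: "real \<Rightarrow> real \<Rightarrow> nat \<Rightarrow> (nat \<Rightarrow> real) set" where
  "cube a b n = {x \<in> Rn n. \<forall>i<n. a \<le> x i \<and> x i \<le> b}"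

definition borel_cube :: "real \<Rightarrow> real \<Rightarrow> nat \<Rightarrow> (nat \<Rightarrow> real) measure" where
  "borel_cube a b n =
     sigma (cube a b n) {S. openin (subtopology (Euclidean_space n) (cube a b n)) S}"


section \<open>Network parameters\<close>

definition param_dim :: "nat \<Rightarrow> (nat \<Rightarrow> nat) \<Rightarrow> nat" where
  "param_dim L l = (\<Sum>k=1..L. l k * (l (k - 1) + 1))"

definition weight :: "(nat \<Rightarrow> nat) \<Rightarrow> nat \<Rightarrow> (nat \<Rightarrow> real) \<Rightarrow> nat \<Rightarrow> nat \<Rightarrow> real" where
  "weight l k \<theta> i j = \<theta> (i * l (k - 1) + j + (\<Sum>h=1..k-1. l h * (l (h - 1) + 1)))"

definition bias :: "(nat \<Rightarrow> nat) \<Rightarrow> nat \<Rightarrow> (nat \<Rightarrow> real) \<Rightarrow> nat \<Rightarrow> real" where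
  "bias l k \<theta> i = \<theta> (l k * l (k - 1) + i + (\<Sum>h=1..k-1. l h * (l (h - 1) + 1)))"

definition affine :: "(nat \<Rightarrow> nat) \<Rightarrow> nat \<Rightarrow> (nat \<Rightarrow> real) \<Rightarrow> (nat \<Rightarrow> real) \<Rightarrow> nat \<Rightarrow> real" where
  "affine l k \<theta> x =
     (\<lambda>i. if i < l k then bias l k \<theta> i + (\<Sum>j<l (k - 1). weight l k \<theta> i j * x j) else 0)"

definition Vrow :: "(nat \<Rightarrow> nat) \<Rightarrow> nat \<Rightarrow> (nat \<Rightarrow> real) \<Rightarrow> nat \<Rightarrow> nat \<Rightarrow> real" where
  "Vrow l k \<theta> i =
     (\<lambda>j. if j < l (k - 1) then weight l k \<theta> i j else if j = l (k - 1) then bias l k \<theta> i else 0)"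

definition Vnorm :: "(nat \<Rightarrow> nat) \<Rightarrow> nat \<Rightarrow> (nat \<Rightarrow> real) \<Rightarrow> nat \<Rightarrow> real" where
  "Vnorm l k \<theta> i = enorm (l (k - 1) + 1) (Vrow l k \<theta> i)"

definition hidden_neurons :: "nat \<Rightarrow> (nat \<Rightarrow> nat) \<Rightarrow> (nat \<times> nat) set" where
  "hidden_neurons L l = (\<Union>k\<in>{1..L-1}. {k} \<times> {..<l k})"


section \<open>The network with centered last hidden layer\<close>

definition relu :: "(nat \<Rightarrow> real) \<Rightarrow> nat \<Rightarrow> real" where
  "relu x = (\<lambda>i. max (x i) 0)"

text \<open>Layers start at 1; the value at layer 0 is irrelevant. The vector-valued integral is taken
  componentwise.\<close>

fun net :: "(nat \<Rightarrow> real) measure \<Rightarrow> nat \<Rightarrow> (nat \<Rightarrow> nat) \<Rightarrow> nat \<Rightarrow> (nat \<Rightarrow> real) \<Rightarrow>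
    (nat \<Rightarrow> real) \<Rightarrow> nat \<Rightarrow> real" where
  "net \<mu> L l 0 \<theta> x = undefined"
| "net \<mu> L l (Suc 0) \<theta> x = affine l 1 \<theta> x"
| "net \<mu> L l (Suc (Suc k)) \<theta> x =
     affine l (Suc (Suc k)) \<theta>
       (\<lambda>j. relu (net \<mu> L l (Suc k) \<theta> x) j -
            indicator {L} (Suc (Suc k)) * (\<integral>y. relu (net \<mu> L l (Suc k) \<theta> y) j \<partial>\<mu>))"


section \<open>The layerwise rescaling\<close>

definition rho :: "nat \<Rightarrow> (nat \<Rightarrow> real) \<Rightarrow> nat \<Rightarrow> real" where
  "rho n x = (\<lambda>i. inverse (enorm n x + indicator {0} (enorm n x)) * x i)"

text \<open>The parameter vector with prescribed rows \<open>V K i\<close>.\<close>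

definition params_of_rows ::
    "nat \<Rightarrow> (nat \<Rightarrow> nat) \<Rightarrow> (nat \<Rightarrow> nat \<Rightarrow> nat \<Rightarrow> real) \<Rightarrow> nat \<Rightarrow> real" where
  "params_of_rows L l V =
     (THE \<theta>. \<theta> \<in> Rn (param_dim L l) \<and> (\<forall>K\<in>{1..L}. \<forall>i<l K. Vrow l K \<theta> i = V K i))"

definition rescaled_row ::
    "(nat \<Rightarrow> nat) \<Rightarrow> nat \<Rightarrow> (nat \<Rightarrow> real) \<Rightarrow> nat \<Rightarrow> nat \<Rightarrow> nat \<Rightarrow> real" where
  "rescaled_row l k \<theta> K i =
     (if K = k then rho (l (K - 1) + 1) (Vrow l K \<theta> i)
      else if K = k + 1 then (\<lambda>j. (if j < l k then Vnorm l k \<theta> j else 1) * Vrow l K \<theta> i j)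
      else Vrow l K \<theta> i)"

primrec Psi :: "nat \<Rightarrow> (nat \<Rightarrow> nat) \<Rightarrow> nat \<Rightarrow> (nat \<Rightarrow> real) \<Rightarrow> nat \<Rightarrow> real" where
  "Psi L l 0 \<theta> = \<theta>"
| "Psi L l (Suc k) \<theta> = params_of_rows L l (rescaled_row l (Suc k) (Psi L l k \<theta>))"


text \<open>The definite description is well defined, so \<^const>\<open>Psi\<close> satisfies its defining
  recursion (see \<open>Vrow_Psi\<close> below).\<close>

definition slot :: "(nat \<Rightarrow> nat) \<Rightarrow> nat \<times> nat \<times> nat \<Rightarrow> nat" where
  "slot l = (\<lambda>(K, i, j). (if j < l (K - 1) then i * l (K - 1) + j else l K * l (K - 1) + i)
      + (\<Sum>h=1..K-1. l h * (l (h - 1) + 1)))"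

definition slots :: "nat \<Rightarrow> (nat \<Rightarrow> nat) \<Rightarrow> (nat \<times> nat \<times> nat) set" where
  "slots L l = (SIGMA K:{1..L}. {..<l K} \<times> {..l (K - 1)})"

lemma Vrow_slot: "Vrow l K \<theta> i j = (if j \<le> l (K - 1) then \<theta> (slot l (K, i, j)) else 0)"
  by (auto simp: Vrow_def weight_def bias_def slot_def)

lemma block_less:
  assumes "i < (n::nat)" "j \<le> m"
  shows "(if j < m then i * m + j else n * m + i) < n * (m + 1)"
proof -
  have "i * m + m \<le> n * m" using assms(1) mult_le_mono1[of "Suc i" n m] by simp
  then show ?thesis using assms by (auto simp: algebra_simps)
qed

lemma block_inj:
  assumes "i < (n::nat)" "j \<le> m" "i' < n" "j' \<le> m"
    and eq: "(if j < m then i * m + j else n * m + i) = (if j' < m then i' * m + j' else n * m + i')"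
  shows "i = i' \<and> j = j'"
proof -
  have 1: "i * m + m \<le> n * m" "i' * m + m \<le> n * m"
    using assms mult_le_mono1[of "Suc i" n m] mult_le_mono1[of "Suc i'" n m] by simp_all
  consider "j < m" "j' < m" | "j = m" "j' = m" | "j < m" "j' = m" | "j = m" "j' < m"
    using assms by linarith
  then show ?thesis
  proof cases
    case 1
    then have "i * m + j = i' * m + j'" using eq by simp
    then have "(i * m + j) div m = (i' * m + j') div m" "(i * m + j) mod m = (i' * m + j') mod m"
      by simp_all
    with 1 show ?thesis by simp
  qed (use eq 1 in auto)
qed

lemma slot_bounds:
  assumes "1 \<le> K" "i < l K" "j \<le> l (K - 1)"
  shows "(\<Sum>h=1..K-1. l h * (l (h - 1) + 1)) \<le> slot l (K, i, j)"
    and "slot l (K, i, j) < (\<Sum>h=1..K. l h * (l (h - 1) + 1))"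
proof -
  obtain K' where K: "K = Suc K'" using assms(1) by (cases K) auto
  show "(\<Sum>h=1..K-1. l h * (l (h - 1) + 1)) \<le> slot l (K, i, j)"
    by (simp add: slot_def)
  show "slot l (K, i, j) < (\<Sum>h=1..K. l h * (l (h - 1) + 1))"
    using block_less[OF assms(2,3)] by (simp add: slot_def K del: mult_Suc_right cong del: if_weak_cong)
qed

lemma slot_inj: "inj_on (slot l) (slots L l)"
proof (clarsimp simp: inj_on_def)
  fix K i j K' i' j'
  assume in1: "(K, i, j) \<in> slots L l" and in2: "(K', i', j') \<in> slots L l"
    and eq: "slot l (K, i, j) = slot l (K', i', j')"
  have mono: "(\<Sum>h=1..A. l h * (l (h - 1) + 1)) \<le> (\<Sum>h=1..B-1. l h * (l (h - 1) + 1))"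
    if "A < B" for A B using that by (intro sum_mono2) auto
  note b1 = slot_bounds[of K i l j] and b2 = slot_bounds[of K' i' l j']
  have "K = K'"
  proof (rule ccontr)
    assume "K \<noteq> K'"
    then consider "K < K'" | "K' < K" by linarith
    then show False
      using mono[of K K'] mono[of K' K] b1 b2 eq in1 in2 by cases (force simp: slots_def)+
  qed
  moreover from this have "i = i' \<and> j = j'"
    using eq in1 in2 block_inj[of i "l K" j "l (K - 1)" i' j'] by (simp add: slots_def slot_def cong del: if_weak_cong)
  ultimately show "K = K' \<and> i = i' \<and> j = j'" by simp
qed

lemma slot_bij: "bij_betw (slot l) (slots L l) {..<param_dim L l}"
proof -
  have "slot l ` slots L l \<subseteq> {..<param_dim L l}"
  proof clarsimp
    fix K i j assume "(K, i, j) \<in> slots L l"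
    then have K: "1 \<le> K" "K \<le> L" "i < l K" "j \<le> l (K - 1)" by (auto simp: slots_def)
    have "(\<Sum>h=1..K. l h * (l (h - 1) + 1)) \<le> param_dim L l"
      unfolding param_dim_def using K by (intro sum_mono2) auto
    then show "slot l (K, i, j) < param_dim L l"
      using slot_bounds(2)[of K i l j] K by linarith
  qed
  moreover have "card (slot l ` slots L l) = card {..<param_dim L l}"
    unfolding card_image[OF slot_inj] by (simp add: slots_def param_dim_def)
  ultimately show ?thesis
    using slot_inj by (simp add: bij_betw_def card_subset_eq)
qed

lemma ex1_params_of_rows:
  assumes "\<And>K i. K \<in> {1..L} \<Longrightarrow> i < l K \<Longrightarrow> V K i \<in> Rn (l (K - 1) + 1)"
  shows "\<exists>!\<theta>. \<theta> \<in> Rn (param_dim L l) \<and> (\<forall>K\<in>{1..L}. \<forall>i<l K. Vrow l K \<theta> i = V K i)"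
proof (rule ex_ex1I)
  define g where "g = inv_into (slots L l) (slot l)"
  define \<theta> where
    "\<theta> = (\<lambda>m. if m < param_dim L l then (\<lambda>(K, i, j). V K i j) (g m) else 0)"
  have "Vrow l K \<theta> i = V K i" if K: "K \<in> {1..L}" "i < l K" for K i
  proof
    fix j show "Vrow l K \<theta> i j = V K i j"
    proof (cases "j \<le> l (K - 1)")
      case True
      then have s: "(K, i, j) \<in> slots L l" using K by (simp add: slots_def)
      then have "g (slot l (K, i, j)) = (K, i, j)" by (simp add: g_def inv_into_f_f[OF slot_inj])
      moreover have "slot l (K, i, j) < param_dim L l"
        using bij_betwE[OF slot_bij] s by blast
      ultimately show ?thesis using True by (simp add: Vrow_slot \<theta>_def)
    next
      case False
      then show ?thesis using assms[OF K] by (simp add: Vrow_slot topspace_Euclidean_space)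
    qed
  qed
  moreover have "\<theta> \<in> Rn (param_dim L l)" by (simp add: \<theta>_def topspace_Euclidean_space)
  ultimately show "\<exists>\<theta>. \<theta> \<in> Rn (param_dim L l) \<and> (\<forall>K\<in>{1..L}. \<forall>i<l K. Vrow l K \<theta> i = V K i)"
    by blast
next
  fix \<theta> \<theta>'
  assume 1: "\<theta> \<in> Rn (param_dim L l) \<and> (\<forall>K\<in>{1..L}. \<forall>i<l K. Vrow l K \<theta> i = V K i)"
    and 2: "\<theta>' \<in> Rn (param_dim L l) \<and> (\<forall>K\<in>{1..L}. \<forall>i<l K. Vrow l K \<theta>' i = V K i)"
  show "\<theta> = \<theta>'"
  proof
    fix m show "\<theta> m = \<theta>' m"
    proof (cases "m < param_dim L l")
      case True
      then have "m \<in> slot l ` slots L l" using slot_bij[of l L] by (simp add: bij_betw_def)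
      then obtain K i j where m: "m = slot l (K, i, j)" and s: "(K, i, j) \<in> slots L l"
        by (metis imageE prod_cases3)
      have "Vrow l K \<theta> i j = Vrow l K \<theta>' i j" using 1 2 s by (simp add: slots_def)
      then show ?thesis using s m by (simp add: Vrow_slot slots_def)
    next
      case False
      then show ?thesis using 1 2 by (simp add: topspace_Euclidean_space)
    qed
  qed
qed

lemma rescaled_row_in: "rescaled_row l k \<theta> K i \<in> Rn (l (K - 1) + 1)"
  by (auto simp: rescaled_row_def rho_def Vrow_def topspace_Euclidean_space)

lemma Psi_in:
  assumes "\<theta> \<in> Rn (param_dim L l)"
  shows "Psi L l k \<theta> \<in> Rn (param_dim L l)"
proof (cases k)
  case (Suc k')
  have "\<exists>!\<theta>'. \<theta>' \<in> Rn (param_dim L l) \<and>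
      (\<forall>K\<in>{1..L}. \<forall>i<l K. Vrow l K \<theta>' i = rescaled_row l (Suc k') (Psi L l k' \<theta>) K i)"
    by (intro ex1_params_of_rows rescaled_row_in)
  from theI'[OF this] show ?thesis by (simp add: Suc params_of_rows_def)
qed (use assms in simp)

lemma Vrow_Psi:
  assumes "k \<ge> 1" "K \<in> {1..L}" "i < l K"
  shows "Vrow l K (Psi L l k \<theta>) i =
     (if K = k then rho (l (K - 1) + 1) (Vrow l K (Psi L l (k - 1) \<theta>) i)
      else if K = k + 1 then
        (\<lambda>j. (if j < l k then Vnorm l k (Psi L l (k - 1) \<theta>) j else 1) *
             Vrow l K (Psi L l (k - 1) \<theta>) i j)
      else Vrow l K (Psi L l (k - 1) \<theta>) i)"
proof -
  obtain k' where k: "k = Suc k'" using assms(1) by (cases k) auto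
  have "\<exists>!\<theta>'. \<theta>' \<in> Rn (param_dim L l) \<and>
      (\<forall>K\<in>{1..L}. \<forall>i<l K. Vrow l K \<theta>' i = rescaled_row l (Suc k') (Psi L l k' \<theta>) K i)"
    by (intro ex1_params_of_rows rescaled_row_in)
  from theI'[OF this] have "Vrow l K (Psi L l k \<theta>) i = rescaled_row l (Suc k') (Psi L l k' \<theta>) K i"
    using assms by (simp add: k params_of_rows_def)
  then show ?thesis unfolding rescaled_row_def k diff_Suc_1 by simp
qed

end

theory Submission
  imports Defs
begin

text \<open>The normalized parameters form, up to a free linear factor, a product of unit spheres, one for
  each hidden neuron, because distinct rows occupy disjoint sets of coordinates. Near a point of this
  set every row has a nonvanishing coordinate, which can be traded for the squared norm of the row;
  a square root inverts this change of coordinates. The realization is preserved by every rescaling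
  step because the ReLU and the integral are positively homogeneous, so the factors divided out of
  layer \<open>k\<close> cancel against those multiplied into layer \<open>k + 1\<close>; a row of norm zero yields a neuron
  with constant output zero, both before and after centering.\<close>

section \<open>Calculus of \<open>C\<^sup>k\<close> functions\<close>

text \<open>The product topology is the type class topology on functions, so openness and continuity
  can be treated with the type class notions.\<close>

lemma Euclidean_space_eq_top_of_set: "Euclidean_space n = top_of_set {x. \<forall>i\<ge>n. x i = 0}"
  by (simp add: Euclidean_space_def euclidean_product_topology)

lemma continuous_map_Euclidean_subspace_iff:
  assumes "U \<subseteq> Rn n"
  shows "continuous_map (subtopology (Euclidean_space n) U) euclideanreal f \<longleftrightarrow> continuous_on U f"
  using assms unfolding Euclidean_space_eq_top_of_set topspace_euclidean_subtopology
  by (simp add: subtopology_subtopology Int_absorb1)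

lemma continuous_on_coordinate: "continuous_on U (\<lambda>x::nat \<Rightarrow> real. x j)"
  by (rule continuous_on_product_coordinates[THEN continuous_on_subset]) simp

text \<open>A partial derivative sees a function only on a coordinate line. This line stays in the
  open set \<open>U\<close> for parameters near \<open>x i\<close>; \<open>i < n\<close> keeps it
  inside \<open>Rn n\<close>.\<close>

lemma eventually_fun_upd_mem:
  assumes "openin (Euclidean_space n) U" "x \<in> U" "i < n"
  shows "eventually (\<lambda>t. x(i := t) \<in> U) (nhds (x i))"
proof -
  obtain T where T: "open T" "U = Rn n \<inter> T"
    using assms(1) by (auto simp: Euclidean_space_eq_top_of_set openin_open)
  have cont: "continuous_on UNIV (\<lambda>t. x(i := t))"
  proof (rule continuous_on_coordinatewise_then_product)
    show "continuous_on UNIV (\<lambda>t. (x(i := t)) j)" for j by (cases "j = i") auto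
  qed
  then have "open ((\<lambda>t. x(i := t)) -` T)" using T(1) by (simp add: open_vimage)
  moreover have "x i \<in> (\<lambda>t. x(i := t)) -` T" using assms(2) T by simp
  ultimately have "eventually (\<lambda>t. t \<in> (\<lambda>t. x(i := t)) -` T) (nhds (x i))"
    by (rule eventually_nhds_in_open)
  then have "eventually (\<lambda>t. x(i := t) \<in> T) (nhds (x i))" by simp
  moreover have "x(i := t) \<in> Rn n" for t
    using assms T by (auto simp: topspace_Euclidean_space)
  ultimately show ?thesis using T(2) by simp
qed

context
  fixes n :: nat and U :: "(nat \<Rightarrow> real) set"
  assumes U: "openin (Euclidean_space n) U"
begin

lemma open_subset_Rn: "U \<subseteq> Rn n"
  using U by (rule openin_subset)

lemma Ck_on_imp_continuous: "Ck_on k n U f \<Longrightarrow> continuous_on U f"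
  by (cases k) (simp_all add: continuous_map_Euclidean_subspace_iff[OF open_subset_Rn])

lemma eventually_fun_upd_eq:
  assumes "\<And>x. x \<in> U \<Longrightarrow> f x = g x" "x \<in> U" "i < n"
  shows "eventually (\<lambda>t. f (x(i := t)) = g (x(i := t))) (nhds (x i))"
  using eventually_fun_upd_mem[OF U assms(2,3)] by (rule eventually_mono) (rule assms(1))

lemma partial_deriv_cong:
  assumes "\<And>x. x \<in> U \<Longrightarrow> f x = g x" "x \<in> U" "i < n"
  shows "partial_deriv i f x = partial_deriv i g x"
  unfolding partial_deriv_def by (rule deriv_cong_ev[OF eventually_fun_upd_eq[OF assms] refl])

text \<open>Derivatives at a point of the open set \<open>U\<close> depend only on values in
  \<open>U\<close>. The induction varies \<open>f\<close> and \<open>g\<close>, since its step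
  passes to their partial derivatives.\<close>

lemma Ck_on_cong:
  assumes "\<And>x. x \<in> U \<Longrightarrow> f x = g x" "Ck_on k n U f"
  shows "Ck_on k n U g"
  using assms
proof (induction k arbitrary: f g)
  case 0
  then show ?case
    using continuous_on_cong[of U U f g]
    by (simp add: continuous_map_Euclidean_subspace_iff[OF open_subset_Rn])
next
  case (Suc k)
  have "(\<lambda>t. g (x(i := t))) differentiable at (x i)" if x: "x \<in> U" and i: "i < n" for x i
  proof -
    have "(\<lambda>t. f (x(i := t))) differentiable at (x i)"
      using Suc.prems(2) x i unfolding Ck_on.simps by blast
    then obtain D where "((\<lambda>t. f (x(i := t))) has_real_derivative D) (at (x i))"
      by (rule real_differentiableE)
    then have "((\<lambda>t. g (x(i := t))) has_real_derivative D) (at (x i))"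
      using DERIV_cong_ev[OF refl eventually_fun_upd_eq[of f g x i] refl, of D] Suc.prems(1) x i by simp
    then show ?thesis unfolding real_differentiable_def by (rule exI)
  qed
  moreover have "Ck_on k n U (partial_deriv i g)" if i: "i < n" for i
  proof (rule Suc.IH)
    show "partial_deriv i f x = partial_deriv i g x" if "x \<in> U" for x
      by (rule partial_deriv_cong[OF Suc.prems(1) that i])
    show "Ck_on k n U (partial_deriv i f)" using Suc.prems(2) i by simp
  qed
  moreover have "continuous_on U g"
    by (rule continuous_on_cong[OF refl Suc.prems(1), THEN iffD1, OF _ Ck_on_imp_continuous[OF Suc.prems(2)]])
  ultimately show ?case
    unfolding Ck_on.simps continuous_map_Euclidean_subspace_iff[OF open_subset_Rn] by blast
qed

text \<open>This lets a candidate formula \<open>f'\<close>, correct merely on \<open>U\<close>,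
  stand in for \<open>partial_deriv\<close>. Each closure rule below then reduces to a
  differentiation rule and the regularity of a formula.\<close>

lemma Ck_on_SucI:
  assumes "continuous_on U f"
    and "\<And>i. i < n \<Longrightarrow> Ck_on k n U (f' i)"
    and "\<And>i x. i < n \<Longrightarrow> x \<in> U \<Longrightarrow> ((\<lambda>t. f (x(i := t))) has_real_derivative f' i x) (at (x i))"
  shows "Ck_on (Suc k) n U f"
proof -
  have "Ck_on k n U (partial_deriv i f)" if "i < n" for i
  proof (rule Ck_on_cong[OF _ assms(2)[OF that]])
    show "f' i x = partial_deriv i f x" if "x \<in> U" for x
      unfolding partial_deriv_def by (rule DERIV_imp_deriv[OF assms(3)[OF \<open>i < n\<close> that], symmetric])
  qed
  moreover have "(\<lambda>t. f (x(i := t))) differentiable at (x i)" if "i < n" "x \<in> U" for i x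
    using assms(3)[OF that] unfolding real_differentiable_def by (rule exI)
  ultimately show ?thesis using assms(1)
    unfolding Ck_on.simps continuous_map_Euclidean_subspace_iff[OF open_subset_Rn] by blast
qed

lemma Ck_on_Suc_deriv:
  assumes "Ck_on (Suc k) n U f" "i < n" "x \<in> U"
  shows "((\<lambda>t. f (x(i := t))) has_real_derivative partial_deriv i f x) (at (x i))"
proof -
  have "(\<lambda>t. f (x(i := t))) differentiable at (x i)"
    using assms unfolding Ck_on.simps by blast
  then show ?thesis
    unfolding partial_deriv_def by (rule DERIV_deriv_iff_real_differentiable[THEN iffD2])
qed

lemma Ck_on_Suc_partial: "Ck_on (Suc k) n U f \<Longrightarrow> i < n \<Longrightarrow> Ck_on k n U (partial_deriv i f)"
  by simp

text \<open>The recursion records order \<open>Suc k\<close> only through the partial derivatives,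
  so the order has to be lowered in these first, by induction.\<close>

lemma Ck_on_SucD: "Ck_on (Suc k) n U f \<Longrightarrow> Ck_on k n U f"
proof (induction k arbitrary: f)
  case 0
  then show ?case by simp
next
  case (Suc k)
  show ?case
  proof (rule Ck_on_SucI[where f' = "\<lambda>i. partial_deriv i f"])
    show "continuous_on U f" by (rule Ck_on_imp_continuous[OF Suc.prems])
    show "Ck_on k n U (partial_deriv i f)" if "i < n" for i
      by (rule Suc.IH[OF Ck_on_Suc_partial[OF Suc.prems that]])
  qed (rule Ck_on_Suc_deriv[OF Suc.prems])
qed

section \<open>Closure properties of C^k functions\<close>

lemma Ck_on_const: "Ck_on k n U (\<lambda>_. c)"
proof (induction k arbitrary: c)
  case (Suc k)
  show ?case by (rule Ck_on_SucI[where f' = "\<lambda>_ _. 0"]) (auto intro: Suc)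
qed simp

lemma Ck_on_coordinate: "Ck_on k n U (\<lambda>x. x j)"
proof (cases k)
  case 0
  then show ?thesis
    by (simp add: continuous_map_Euclidean_subspace_iff[OF open_subset_Rn] continuous_on_coordinate)
next
  case (Suc k')
  have "((\<lambda>t. (x(i := t)) j) has_real_derivative (if i = j then 1 else 0)) (at (x i))" for i x
    by auto
  then show ?thesis unfolding Suc
    by (intro Ck_on_SucI[where f' = "\<lambda>i _. if i = j then 1 else 0"])
      (auto intro: Ck_on_const continuous_on_coordinate)
qed

lemma Ck_on_add: "Ck_on k n U f \<Longrightarrow> Ck_on k n U g \<Longrightarrow> Ck_on k n U (\<lambda>x. f x + g x)"
proof (induction k arbitrary: f g)
  case 0
  then show ?case by (simp add: continuous_map_add)
next
  case (Suc k)
  show ?case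
  proof (rule Ck_on_SucI[where f' = "\<lambda>i x. partial_deriv i f x + partial_deriv i g x"])
    show "continuous_on U (\<lambda>x. f x + g x)"
      by (rule continuous_on_add[OF Suc.prems[THEN Ck_on_imp_continuous]])
    show "Ck_on k n U (\<lambda>x. partial_deriv i f x + partial_deriv i g x)" if "i < n" for i
      by (rule Suc.IH[OF Suc.prems[THEN Ck_on_Suc_partial[OF _ that]]])
    show "((\<lambda>t. f (x(i := t)) + g (x(i := t))) has_real_derivative
        partial_deriv i f x + partial_deriv i g x) (at (x i))" if "i < n" "x \<in> U" for i x
      by (rule DERIV_add[OF Ck_on_Suc_deriv[OF Suc.prems(1) that] Ck_on_Suc_deriv[OF Suc.prems(2) that]])
  qed
qed

text \<open>The product rule pairs a partial derivative of order \<open>k\<close> with an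
  undifferentiated factor of order \<open>Suc k\<close>; the factor is first lowered to order
  \<open>k\<close> to meet the induction hypothesis.\<close>

lemma Ck_on_mult: "Ck_on k n U f \<Longrightarrow> Ck_on k n U g \<Longrightarrow> Ck_on k n U (\<lambda>x. f x * g x)"
proof (induction k arbitrary: f g)
  case 0
  then show ?case by (simp add: continuous_map_real_mult)
next
  case (Suc k)
  show ?case
  proof (rule Ck_on_SucI[where f' = "\<lambda>i x. partial_deriv i f x * g x + partial_deriv i g x * f x"])
    show "continuous_on U (\<lambda>x. f x * g x)"
      by (rule continuous_on_mult[OF Suc.prems[THEN Ck_on_imp_continuous]])
    show "Ck_on k n U (\<lambda>x. partial_deriv i f x * g x + partial_deriv i g x * f x)" if "i < n" for i
      using Suc.prems[THEN Ck_on_Suc_partial[OF _ that]] Suc.prems[THEN Ck_on_SucD]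
      by (intro Ck_on_add Suc.IH)
    show "((\<lambda>t. f (x(i := t)) * g (x(i := t))) has_real_derivative
        partial_deriv i f x * g x + partial_deriv i g x * f x) (at (x i))" if "i < n" "x \<in> U" for i x
      using DERIV_mult[of "\<lambda>t. f (x(i := t))" _ _ _ "\<lambda>t. g (x(i := t))",
          OF Ck_on_Suc_deriv[OF Suc.prems(1) that] Ck_on_Suc_deriv[OF Suc.prems(2) that]]
      by simp
  qed
qed

text \<open>Bootstrapping: the derivative of 1/f is again expressed through 1/f, whose regularity of
  one order less is the induction hypothesis. Hence \<open>f\<close> stays fixed.\<close>

lemma Ck_on_inverse:
  assumes "\<And>x. x \<in> U \<Longrightarrow> f x \<noteq> 0"
  shows "Ck_on k n U f \<Longrightarrow> Ck_on k n U (\<lambda>x. inverse (f x))"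
proof (induction k)
  case 0
  then show ?case using assms
    by (simp add: continuous_map_Euclidean_subspace_iff[OF open_subset_Rn] continuous_on_inverse)
next
  case (Suc k)
  \<comment> \<open>Sign and square are written as products, so that the rules for products and
    constants suffice.\<close>
  let ?f' = "\<lambda>i x. (- 1 * partial_deriv i f x) * (inverse (f x) * inverse (f x))"
  show ?case
  proof (rule Ck_on_SucI[where f' = ?f'])
    show "continuous_on U (\<lambda>x. inverse (f x))"
      using assms by (auto intro: continuous_on_inverse Ck_on_imp_continuous[OF Suc.prems])
    show "((\<lambda>t. inverse (f (x(i := t)))) has_real_derivative ?f' i x) (at (x i))"
      if "i < n" "x \<in> U" for i x
      using DERIV_inverse_fun[of "\<lambda>t. f (x(i := t))", OF Ck_on_Suc_deriv[OF Suc.prems that]] assms[OF that(2)]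
      by (simp add: algebra_simps)
    show "Ck_on k n U (?f' i)" if "i < n" for i
      using Suc.IH Ck_on_SucD[OF Suc.prems] Ck_on_Suc_partial[OF Suc.prems that]
      by (intro Ck_on_mult Ck_on_const)
  qed
qed

text \<open>The same bootstrapping works, as the derivative f'/(2 sqrt f) contains
  \<open>sqrt\<close> of \<open>f\<close> itself. Positivity keeps the argument away from the point
  0, where the root is not differentiable.\<close>

lemma Ck_on_sqrt:
  assumes "\<And>x. x \<in> U \<Longrightarrow> f x > 0"
  shows "Ck_on k n U f \<Longrightarrow> Ck_on k n U (\<lambda>x. sqrt (f x))"
proof (induction k)
  case 0
  then show ?case
    by (simp add: continuous_map_Euclidean_subspace_iff[OF open_subset_Rn] continuous_on_real_sqrt)
next
  case (Suc k)
  let ?f' = "\<lambda>i x. (1/2 * partial_deriv i f x) * inverse (sqrt (f x))"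
  show ?case
  proof (rule Ck_on_SucI[where f' = ?f'])
    show "continuous_on U (\<lambda>x. sqrt (f x))"
      by (intro continuous_on_real_sqrt Ck_on_imp_continuous[OF Suc.prems])
    show "((\<lambda>t. sqrt (f (x(i := t)))) has_real_derivative ?f' i x) (at (x i))"
      if "i < n" "x \<in> U" for i x
      using DERIV_chain2[of sqrt "inverse (sqrt (f x)) / 2" "\<lambda>t. f (x(i := t))",
          OF _ Ck_on_Suc_deriv[OF Suc.prems that]] DERIV_real_sqrt[of "f x"] assms[OF that(2)]
      by (simp add: mult.commute)
    show "Ck_on k n U (?f' i)" if "i < n" for i
    proof (intro Ck_on_mult Ck_on_const)
      show "Ck_on k n U (partial_deriv i f)" by (rule Ck_on_Suc_partial[OF Suc.prems that])
      have "sqrt (f x) \<noteq> 0" if "x \<in> U" for x using assms[OF that] by simp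
      then show "Ck_on k n U (\<lambda>x. inverse (sqrt (f x)))"
        by (rule Ck_on_inverse[OF _ Suc.IH[OF Ck_on_SucD[OF Suc.prems]]])
    qed
  qed
qed

lemma Ck_on_sum: "(\<And>i. i \<in> A \<Longrightarrow> Ck_on k n U (f i)) \<Longrightarrow> Ck_on k n U (\<lambda>x. \<Sum>i\<in>A. f i x)"
  by (induction A rule: infinite_finite_induct) (simp_all add: Ck_on_const Ck_on_add del: Ck_on.simps)

end

section \<open>Products of spheres as submanifolds\<close>

text \<open>Domain and range of the chart below are both cut out by finitely many strict
  inequalities.\<close>

lemma openin_Euclidean_space_pos:
  assumes "finite I" "\<And>i. i \<in> I \<Longrightarrow> continuous_on UNIV (f i :: (nat \<Rightarrow> real) \<Rightarrow> real)"
  shows "openin (Euclidean_space n) {x \<in> Rn n. \<forall>i\<in>I. f i x > 0}"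
proof -
  have "open (\<Inter>i\<in>I. {x. f i x > 0})"
    using assms by (intro open_INT ballI open_Collect_less) auto
  moreover have "{x \<in> Rn n. \<forall>i\<in>I. f i x > 0} = Rn n \<inter> (\<Inter>i\<in>I. {x. f i x > 0})" by auto
  ultimately show ?thesis
    unfolding Euclidean_space_eq_top_of_set topspace_euclidean_subtopology openin_open by blast
qed

text \<open>The definition speaks of \<open>inv_into U \<phi>\<close>, which agrees with the
  explicit inverse \<open>\<psi>\<close> on \<open>V\<close>; smoothness is transferred along this
  agreement.\<close>

lemma smooth_diffeoI:
  assumes U: "openin (Euclidean_space n) U" and V: "openin (Euclidean_space n) V"
    and \<phi>: "\<And>x. x \<in> U \<Longrightarrow> \<phi> x \<in> V \<and> \<psi> (\<phi> x) = x"
    and \<psi>: "\<And>y. y \<in> V \<Longrightarrow> \<psi> y \<in> U \<and> \<phi> (\<psi> y) = y"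
    and smooth: "\<And>k j. j < n \<Longrightarrow> Ck_on k n U (\<lambda>x. \<phi> x j)"
      "\<And>k j. j < n \<Longrightarrow> Ck_on k n V (\<lambda>y. \<psi> y j)"
  shows "smooth_diffeo n U V \<phi>"
proof -
  have bij: "bij_betw \<phi> U V" by (rule bij_betwI[where g = \<psi>]) (use \<phi> \<psi> in auto)
  have inv: "inv_into U \<phi> y = \<psi> y" if "y \<in> V" for y
    using bij \<psi>[OF that] by (metis bij_betw_def inv_into_f_f)
  have "Ck_on k n V (\<lambda>y. inv_into U \<phi> y j)" if "j < n" for k j
    by (rule Ck_on_cong[OF V _ smooth(2)[OF that]]) (simp add: inv)
  moreover have "\<phi> ` U \<subseteq> Rn n" "inv_into U \<phi> ` V \<subseteq> Rn n"
    using \<phi> \<psi> open_subset_Rn[OF U] open_subset_Rn[OF V] inv by auto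
  ultimately show ?thesis using U V bij smooth(1)
    by (simp add: smooth_diffeo_def smooth_map_on_def)
qed

text \<open>A slice requires the last coordinates to vanish, so the coordinates that carry the
  equations must be permuted to the end.\<close>

lemma ex_bij_betw_moving_last:
  assumes "S \<subseteq> {..<n::nat}"
  obtains \<pi> where "bij_betw \<pi> {..<n} {..<n}"
    "\<And>j. j < n \<Longrightarrow> \<pi> j \<in> S \<longleftrightarrow> n - card S \<le> j"
proof -
  have fin: "finite S" using assms finite_subset by blast
  have le: "card S \<le> n" using card_mono[OF _ assms] by simp
  have "\<exists>f. bij_betw f {..<n - card S} ({..<n} - S)"
    using assms fin by (intro finite_same_card_bij) (auto simp: card_Diff_subset)
  moreover have "\<exists>g. bij_betw g {n - card S..<n} S"
    using fin le by (intro finite_same_card_bij) auto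
  ultimately obtain f g
    where f: "bij_betw f {..<n - card S} ({..<n} - S)" and g: "bij_betw g {n - card S..<n} S"
    by blast
  define \<pi> where "\<pi> j = (if j < n - card S then f j else g j)" for j
  have "bij_betw \<pi> {..<n - card S} ({..<n} - S)" "bij_betw \<pi> {n - card S..<n} S"
    using f g bij_betw_cong[of "{..<n - card S}" \<pi> f] bij_betw_cong[of "{n - card S..<n}" \<pi> g]
    by (simp_all add: \<pi>_def)
  then have "bij_betw \<pi> ({..<n - card S} \<union> {n - card S..<n}) (({..<n} - S) \<union> S)"
    by (rule bij_betw_combine) auto
  moreover have "{..<n - card S} \<union> {n - card S..<n} = {..<n}" "({..<n} - S) \<union> S = {..<n}"
    using assms by auto
  ultimately have "bij_betw \<pi> {..<n} {..<n}" by simp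
  moreover have "\<pi> j \<in> S \<longleftrightarrow> n - card S \<le> j" if "j < n" for j
    using bij_betwE[OF f] bij_betwE[OF g] that by (auto simp: \<pi>_def)
  ultimately show thesis by (rule that)
qed

text \<open>The chart replaces each coordinate \<open>k \<in> S\<close> by the squared norm of its block \<open>B k\<close> minus one
  and moves these coordinates to the end.\<close>

lemma sphere_product_chart:
  assumes S: "S \<subseteq> {..<n}"
    and B: "\<And>k. k \<in> S \<Longrightarrow> B k \<subseteq> {..<n} \<and> B k \<inter> S = {k}"
    and p: "p \<in> Rn n" "\<And>k. k \<in> S \<Longrightarrow> p k \<noteq> 0"
  shows "\<exists>U V \<phi>. p \<in> U \<and> smooth_diffeo n U V \<phi> \<and>
    \<phi> ` (U \<inter> {x \<in> Rn n. \<forall>k\<in>S. (\<Sum>j\<in>B k. (x j)\<^sup>2) = 1}) = V \<inter> Rn (n - card S)"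
proof -
  define m where "m = n - card S"
  obtain \<pi> where \<pi>: "bij_betw \<pi> {..<n} {..<n}" and \<pi>S: "\<And>j. j < n \<Longrightarrow> \<pi> j \<in> S \<longleftrightarrow> m \<le> j"
    using ex_bij_betw_moving_last[OF S] unfolding m_def by blast
  \<comment> \<open>The chart puts coordinate \<open>\<pi> j\<close> at position \<open>j\<close>;
    thus \<open>\<pi>' k\<close> is the position where coordinate \<open>k\<close> is found.\<close>
  define \<pi>' where "\<pi>' = inv_into {..<n} \<pi>"
  have \<pi>_less: "\<pi> j < n" "\<pi>' (\<pi> j) = j" if "j < n" for j
    using that \<pi> bij_betwE[OF \<pi>] by (auto simp: \<pi>'_def bij_betw_def)
  have \<pi>'_less: "\<pi>' k < n" "\<pi> (\<pi>' k) = k" if "k < n" for k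
    using that bij_betwE[OF bij_betw_inv_into[OF \<pi>]] bij_betw_inv_into_right[OF \<pi>]
    by (auto simp: \<pi>'_def)
  have S_less: "k < n" if "k \<in> S" for k using S that by auto
  have finB: "finite (B k)" if "k \<in> S" for k
    using B[OF that] finite_subset by blast
  have finS: "finite S" using S finite_subset by blast
  have split: "(\<Sum>j\<in>B k. h j) = h k + (\<Sum>j\<in>B k - {k}. h j)" if "k \<in> S" for k and h :: "nat \<Rightarrow> real"
    using that B[OF that] finB[OF that] by (intro sum.remove) auto
  have rest: "j < n" "j \<notin> S" if "k \<in> S" "j \<in> B k - {k}" for j k
    using B[OF that(1)] that(2) by auto
  \<comment> \<open>Fixing the signs of the coordinates in \<open>S\<close> to those at
    \<open>p\<close> makes each of them recoverable from its square.\<close>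
  define U where "U = {x \<in> Rn n. \<forall>k\<in>S. sgn (p k) * x k > 0}"
  \<comment> \<open>This solves the chart equation for the square of coordinate \<open>k\<close>:
    the other coordinates of its block lie outside \<open>S\<close> and are only moved by the
    chart.\<close>
  define r where "r k y = 1 + y (\<pi>' k) - (\<Sum>j\<in>B k - {k}. (y (\<pi>' j))\<^sup>2)" for k and y :: "nat \<Rightarrow> real"
  define V where "V = {y \<in> Rn n. \<forall>k\<in>S. r k y > 0}"
  define \<phi> where "\<phi> x j = (if j < m then x (\<pi> j) else
      if j < n then (\<Sum>i\<in>B (\<pi> j). (x i)\<^sup>2) - 1 else 0)" for x :: "nat \<Rightarrow> real" and j
  define \<psi> where "\<psi> y k = (if k \<in> S then sgn (p k) * sqrt (r k y) else
      if k < n then y (\<pi>' k) else 0)" for y :: "nat \<Rightarrow> real" and k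
  have sgn_sq: "sgn (p k) * sgn (p k) = 1" if "k \<in> S" for k
    using p(2)[OF that] by (simp add: sgn_if)
  have \<phi>_notin: "\<phi> x (\<pi>' k) = x k" if "k < n" "k \<notin> S" for x k
    using that \<pi>S[of "\<pi>' k"] \<pi>'_less[of k] by (auto simp: \<phi>_def)
  have \<phi>_in: "\<phi> x (\<pi>' k) = (\<Sum>i\<in>B k. (x i)\<^sup>2) - 1" if "k \<in> S" for x k
    using that \<pi>S[of "\<pi>' k"] \<pi>'_less[of k] S_less by (auto simp: \<phi>_def)
  have r_\<phi>: "r k (\<phi> x) = (x k)\<^sup>2" if "k \<in> S" for k x
    using rest[OF that] by (simp add: r_def \<phi>_in[OF that] \<phi>_notin split[OF that])
  have \<psi>_sq: "(\<psi> y k)\<^sup>2 = r k y" if "k \<in> S" "y \<in> V" for k y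
  proof -
    have "r k y > 0" using that by (simp add: V_def)
    then show ?thesis using sgn_sq[OF that(1)] that(1)
      by (simp add: \<psi>_def power_mult_distrib power2_eq_square[of "sgn _"])
  qed
  have openU: "openin (Euclidean_space n) U"
    unfolding U_def by (intro openin_Euclidean_space_pos finS continuous_intros continuous_on_coordinate)
  have openV: "openin (Euclidean_space n) V"
    unfolding V_def r_def
    by (intro openin_Euclidean_space_pos finS continuous_intros continuous_on_coordinate)
  have \<phi>_V: "\<phi> x \<in> V \<and> \<psi> (\<phi> x) = x" if x: "x \<in> U" for x
  proof
    have pos: "sgn (p k) * x k > 0" if "k \<in> S" for k using x that by (simp add: U_def)
    then have "r k (\<phi> x) > 0" if "k \<in> S" for k
      using that r_\<phi>[OF that, of x] by (metis less_irrefl mult_zero_right zero_less_power2)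
    moreover have "\<phi> x \<in> Rn n" by (auto simp: \<phi>_def topspace_Euclidean_space m_def)
    ultimately show "\<phi> x \<in> V" by (simp add: V_def)
    have "\<psi> (\<phi> x) k = x k" for k
    proof (cases "k \<in> S")
      case True
      have "\<bar>x k\<bar> = sgn (p k) * x k"
        using pos[OF True] p(2)[OF True] by (auto simp: sgn_if split: if_splits)
      then show ?thesis using True sgn_sq[OF True]
        by (simp add: \<psi>_def r_\<phi>[OF True] flip: mult.assoc)
    next
      case False
      then show ?thesis using x by (auto simp: \<psi>_def \<phi>_notin U_def topspace_Euclidean_space)
    qed
    then show "\<psi> (\<phi> x) = x" by blast
  qed
  have \<psi>_U: "\<psi> y \<in> U \<and> \<phi> (\<psi> y) = y" if y: "y \<in> V" for y
  proof
    have "sgn (p k) * \<psi> y k > 0" if "k \<in> S" for k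
    proof -
      have "sgn (p k) * \<psi> y k = (sgn (p k) * sgn (p k)) * sqrt (r k y)"
        using that by (simp add: \<psi>_def)
      also have "\<dots> = sqrt (r k y)" unfolding sgn_sq[OF that] by simp
      also have "\<dots> > 0" using y that by (simp add: V_def)
      finally show ?thesis .
    qed
    moreover have "\<psi> y \<in> Rn n" using S_less by (fastforce simp: \<psi>_def topspace_Euclidean_space)
    ultimately show "\<psi> y \<in> U" by (simp add: U_def)
    have "\<phi> (\<psi> y) j = y j" for j
    proof -
      consider "j < m" | "m \<le> j" "j < n" | "n \<le> j" by linarith
      then show ?thesis
      proof cases
        case 1
        then have "j < n" by (simp add: m_def)
        then show ?thesis using 1 \<pi>S[of j] \<pi>_less[of j] by (simp add: \<phi>_def \<psi>_def)
      next
        case 2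
        then have k: "\<pi> j \<in> S" using \<pi>S by simp
        have "(\<Sum>i\<in>B (\<pi> j). (\<psi> y i)\<^sup>2) = r (\<pi> j) y + (\<Sum>i\<in>B (\<pi> j) - {\<pi> j}. (y (\<pi>' i))\<^sup>2)"
          unfolding split[OF k] \<psi>_sq[OF k y]
          using rest[OF k] by (intro arg_cong2[of _ _ _ _ "(+)"] sum.cong) (auto simp: \<psi>_def)
        then show ?thesis using 2 \<pi>_less[of j] by (simp add: \<phi>_def r_def)
      next
        case 3
        then show ?thesis using y by (simp add: \<phi>_def m_def V_def topspace_Euclidean_space)
      qed
    qed
    then show "\<phi> (\<psi> y) = y" by blast
  qed
  have "smooth_diffeo n U V \<phi>"
  proof (rule smooth_diffeoI[OF openU openV \<phi>_V \<psi>_U])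
    show "Ck_on k n U (\<lambda>x. \<phi> x j)" if "j < n" for k j
    proof (cases "j < m")
      case True
      then show ?thesis by (simp add: \<phi>_def Ck_on_coordinate[OF openU] del: Ck_on.simps)
    next
      case False
      have "Ck_on k n U (\<lambda>x. (\<Sum>i\<in>B (\<pi> j). x i * x i) + - 1)"
        by (intro Ck_on_add Ck_on_sum Ck_on_mult Ck_on_coordinate Ck_on_const openU)
      then show ?thesis using False that by (simp add: \<phi>_def power2_eq_square)
    qed
    show "Ck_on k n V (\<lambda>y. \<psi> y j)" if "j < n" for k j
    proof (cases "j \<in> S")
      case True
      have "Ck_on k n V (\<lambda>y. (1 + y (\<pi>' j)) + - 1 * (\<Sum>i\<in>B j - {j}. y (\<pi>' i) * y (\<pi>' i)))"
        by (intro Ck_on_add Ck_on_sum Ck_on_mult Ck_on_coordinate Ck_on_const openV)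
      then have "Ck_on k n V (r j)"
        by (simp add: r_def[abs_def] power2_eq_square)
      then have "Ck_on k n V (\<lambda>y. sgn (p j) * sqrt (r j y))"
        using True by (intro Ck_on_mult Ck_on_sqrt Ck_on_const openV) (auto simp: V_def)
      then show ?thesis using True by (simp add: \<psi>_def)
    next
      case False
      then show ?thesis using that by (simp add: \<psi>_def Ck_on_coordinate[OF openV] del: Ck_on.simps)
    qed
  qed
  moreover have "p \<in> U"
  proof -
    have "sgn (p k) * p k > 0" if "k \<in> S" for k using p(2)[OF that] by (simp add: sgn_if)
    then show ?thesis using p(1) by (simp add: U_def)
  qed
  moreover have "\<phi> ` (U \<inter> {x \<in> Rn n. \<forall>k\<in>S. (\<Sum>j\<in>B k. (x j)\<^sup>2) = 1}) = V \<inter> Rn m"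
  proof -
    \<comment> \<open>The positions from \<open>m\<close> to \<open>n - 1\<close> are exactly those
      of the coordinates in \<open>S\<close>, and there the chart records the defects of the sphere
      equations. The set is thus the preimage of the slice.\<close>
    have "\<phi> x \<in> Rn m \<longleftrightarrow> (\<forall>k\<in>S. (\<Sum>j\<in>B k. (x j)\<^sup>2) = 1)" for x
    proof -
      have "\<phi> x \<in> Rn m \<longleftrightarrow> (\<forall>j. m \<le> j \<and> j < n \<longrightarrow> \<phi> x j = 0)"
        by (auto simp: topspace_Euclidean_space \<phi>_def)
      also have "\<dots> \<longleftrightarrow> (\<forall>k\<in>S. \<phi> x (\<pi>' k) = 0)"
      proof
        assume L: "\<forall>j. m \<le> j \<and> j < n \<longrightarrow> \<phi> x j = 0"
        then show "\<forall>k\<in>S. \<phi> x (\<pi>' k) = 0"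
          using \<pi>'_less S_less \<pi>S by (metis (no_types))
      next
        assume R: "\<forall>k\<in>S. \<phi> x (\<pi>' k) = 0"
        show "\<forall>j. m \<le> j \<and> j < n \<longrightarrow> \<phi> x j = 0"
          using R \<pi>_less \<pi>S by (metis (no_types))
      qed
      finally show ?thesis by (simp add: \<phi>_in)
    qed
    then have M: "U \<inter> {x \<in> Rn n. \<forall>k\<in>S. (\<Sum>j\<in>B k. (x j)\<^sup>2) = 1} = {x \<in> U. \<phi> x \<in> Rn m}"
      by (auto simp: U_def)
    show ?thesis unfolding M
    proof
      show "\<phi> ` {x \<in> U. \<phi> x \<in> Rn m} \<subseteq> V \<inter> Rn m" using \<phi>_V by blast
      show "V \<inter> Rn m \<subseteq> \<phi> ` {x \<in> U. \<phi> x \<in> Rn m}"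
      proof
        fix y assume y: "y \<in> V \<inter> Rn m"
        then have "\<psi> y \<in> U" "\<phi> (\<psi> y) = y" using \<psi>_U by blast+
        with y show "y \<in> \<phi> ` {x \<in> U. \<phi> x \<in> Rn m}" by (intro image_eqI[of _ _ "\<psi> y"]) simp_all
      qed
    qed
  qed
  ultimately show ?thesis unfolding m_def by blast
qed

text \<open>A block whose squares sum to 1 has a nonzero entry. Choosing one in each block gives the
  set \<open>S\<close> for the chart; disjointness makes the choice injective and lets each block
  meet \<open>S\<close> in its own entry alone.\<close>

lemma sphere_product_submanifold:
  assumes I: "finite I" and B: "\<And>i. i \<in> I \<Longrightarrow> B i \<subseteq> {..<n}" and disj: "disjoint_family_on B I"
  shows "smooth_submanifold n (n - card I) {x \<in> Rn n. \<forall>i\<in>I. (\<Sum>j\<in>B i. (x j)\<^sup>2) = 1}"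
    (is "smooth_submanifold n _ ?M")
  unfolding smooth_submanifold_def
proof (intro conjI ballI)
  fix p assume p: "p \<in> ?M"
  have "\<exists>j\<in>B i. p j \<noteq> 0" if "i \<in> I" for i
  proof (rule ccontr)
    assume "\<not> (\<exists>j\<in>B i. p j \<noteq> 0)"
    then have "(\<Sum>j\<in>B i. (p j)\<^sup>2) = 0" by (simp add: sum.neutral)
    with p that show False by auto
  qed
  then obtain s where s: "\<And>i. i \<in> I \<Longrightarrow> s i \<in> B i \<and> p (s i) \<noteq> 0" by metis
  have same: "i = i'" if "i \<in> I" "i' \<in> I" "j \<in> B i" "j \<in> B i'" for i i' j
    using disj that by (auto simp: disjoint_family_on_def)
  have inj: "inj_on s I" using s same by (metis inj_onI)
  \<comment> \<open>The chart expects blocks indexed by their chosen coordinate instead of by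
    \<open>I\<close>.\<close>
  define C where "C k = B (inv_into I s k)" for k
  have C: "C (s i) = B i" if "i \<in> I" for i using inj that by (simp add: C_def)
  have "B i \<inter> s ` I = {s i}" if "i \<in> I" for i using s[OF that] s same that by blast
  then have "C k \<subseteq> {..<n} \<and> C k \<inter> s ` I = {k}" if "k \<in> s ` I" for k
    using that B C by force
  moreover have "s ` I \<subseteq> {..<n}" using s B by blast
  moreover have "p k \<noteq> 0" if "k \<in> s ` I" for k using that s by auto
  ultimately have "\<exists>U V \<phi>. p \<in> U \<and> smooth_diffeo n U V \<phi> \<and>
    \<phi> ` (U \<inter> {x \<in> Rn n. \<forall>k\<in>s ` I. (\<Sum>j\<in>C k. (x j)\<^sup>2) = 1}) = V \<inter> Rn (n - card (s ` I))"
    using p by (intro sphere_product_chart) auto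
  moreover have "{x \<in> Rn n. \<forall>k\<in>s ` I. (\<Sum>j\<in>C k. (x j)\<^sup>2) = 1} = ?M" using C by auto
  ultimately show "\<exists>U V \<phi>. p \<in> U \<and> smooth_diffeo n U V \<phi> \<and> \<phi> ` (U \<inter> ?M) = V \<inter> Rn (n - card I)"
    using card_image[OF inj] by simp
qed auto

section \<open>Invariance of the realization under rescaling\<close>

lemma Vnorm_nonneg: "Vnorm l k \<theta> i \<ge> 0"
  by (simp add: Vnorm_def L2_set_nonneg)

lemma Vnorm_eq_0:
  assumes "Vnorm l k \<theta> i = 0"
  shows "Vrow l k \<theta> i j = 0"
proof (cases "j < l (k - 1) + 1")
  case True
  then show ?thesis using assms
    unfolding Vnorm_def L2_set_eq_0_iff[OF finite_lessThan] by blast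
qed (simp add: Vrow_def)

lemma enorm_scale: "enorm n (\<lambda>j. c * x j) = \<bar>c\<bar> * enorm n x"
  by (simp add: L2_set_def power_mult_distrib real_sqrt_mult flip: sum_distrib_left)

lemma enorm_rho: "enorm n x \<noteq> 0 \<Longrightarrow> enorm n (rho n x) = 1"
  unfolding rho_def enorm_scale by (simp add: L2_set_nonneg)

text \<open>The bias is the last entry of the row, so a neuron applies its row to the input extended
  by a final 1.\<close>

lemma affine_Vrow:
  assumes "i < l k"
  shows "affine l k \<theta> x i =
    Vrow l k \<theta> i (l (k - 1)) + (\<Sum>j<l (k - 1). Vrow l k \<theta> i j * x j)"
  using assms by (simp add: affine_def Vrow_def)

lemma affine_cong:
  assumes "\<And>i. i < l k \<Longrightarrow> Vrow l k \<theta> i = Vrow l k \<theta>' i"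
    and "\<And>j. j < l (k - 1) \<Longrightarrow> x j = y j"
  shows "affine l k \<theta> x = affine l k \<theta>' y"
proof
  fix i show "affine l k \<theta> x i = affine l k \<theta>' y i"
  proof (cases "i < l k")
    case True
    then show ?thesis using assms by (simp add: affine_Vrow)
  qed (simp add: affine_def)
qed

text \<open>This is the factor that \<open>rho\<close> applies to a row; the indicator makes it 1
  for a zero row.\<close>

definition row_scale :: "(nat \<Rightarrow> nat) \<Rightarrow> nat \<Rightarrow> (nat \<Rightarrow> real) \<Rightarrow> nat \<Rightarrow> real" where
  "row_scale l k \<theta> i = inverse (Vnorm l k \<theta> i + indicator {0} (Vnorm l k \<theta> i))"

lemma row_scale_nonneg: "row_scale l k \<theta> i \<ge> 0"
  by (simp add: row_scale_def Vnorm_nonneg)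

text \<open>Isolating the argument of the next affine map allows centered and uncentered layers to
  be treated alike.\<close>

definition layer_input :: "(nat \<Rightarrow> real) measure \<Rightarrow> nat \<Rightarrow> (nat \<Rightarrow> nat) \<Rightarrow> nat \<Rightarrow> (nat \<Rightarrow> real) \<Rightarrow>
    (nat \<Rightarrow> real) \<Rightarrow> nat \<Rightarrow> real" where
  "layer_input \<mu> L l k \<theta> x j = relu (net \<mu> L l k \<theta> x) j -
     indicator {L} (Suc k) * (\<integral>y. relu (net \<mu> L l k \<theta> y) j \<partial>\<mu>)"

lemma net_Suc:
  "k \<ge> 1 \<Longrightarrow> net \<mu> L l (Suc k) \<theta> x = affine l (Suc k) \<theta> (layer_input \<mu> L l k \<theta> x)"
  by (cases k) (simp_all add: layer_input_def[abs_def])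

text \<open>A factor \<open>c \<ge> 0\<close> passes through the maximum and out of the integral. It
  also leaves the integral of a nonintegrable function, which is 0 by convention.\<close>

lemma layer_input_cong:
  assumes "\<And>x. net \<mu> L l k \<theta>' x j = c * net \<mu> L l k \<theta> x j" "c \<ge> 0"
  shows "layer_input \<mu> L l k \<theta>' x j = c * layer_input \<mu> L l k \<theta> x j"
proof -
  have "relu (net \<mu> L l k \<theta>' x) j = c * relu (net \<mu> L l k \<theta> x) j" for x
    using assms by (simp add: relu_def max_mult_distrib_left)
  then show ?thesis by (simp add: layer_input_def right_diff_distrib)
qed

lemma layer_input_eq_0:
  assumes "\<And>x. net \<mu> L l k \<theta> x j = 0"
  shows "layer_input \<mu> L l k \<theta> x j = 0"
  by (simp add: layer_input_def relu_def assms)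

text \<open>Agreement of the layers below gives the neuron the same input under both parameter
  vectors, also after centering, which involves all inputs. Treating a single neuron permits a
  separate factor for each.\<close>

lemma net_row_scaled:
  assumes "k \<ge> 1" "i < l k"
    and rows: "Vrow l k \<theta>' i = (\<lambda>j. c * Vrow l k \<theta> i j)"
    and below: "\<And>K x. K \<ge> 1 \<Longrightarrow> K < k \<Longrightarrow> net \<mu> L l K \<theta>' x = net \<mu> L l K \<theta> x"
  shows "net \<mu> L l k \<theta>' x i = c * net \<mu> L l k \<theta> x i"
proof -
  have "affine l k \<theta>' z i = c * affine l k \<theta> z i" for z
    using assms(2) by (simp add: affine_Vrow rows sum_distrib_left distrib_left mult.assoc)
  moreover have "\<exists>z. net \<mu> L l k \<theta>' x = affine l k \<theta>' z \<and> net \<mu> L l k \<theta> x = affine l k \<theta> z"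
  proof (cases "k = 1")
    case False
    then obtain m where m: "k = Suc m" "m \<ge> 1" using assms(1) by (cases k) auto
    then have "layer_input \<mu> L l m \<theta>' = layer_input \<mu> L l m \<theta>"
      using below[of m] by (intro ext) (simp add: layer_input_def)
    with m show ?thesis by (auto simp: net_Suc)
  qed auto
  ultimately show ?thesis by auto
qed

text \<open>Only the outputs of layer \<open>k\<close> change, each by its own nonnegative factor,
  and layer \<open>k + 1\<close> undoes this.\<close>

lemma net_rescale_step:
  assumes "k \<ge> 1" "k < L"
    and rows: "\<And>K i. K \<in> {1..L} \<Longrightarrow> i < l K \<Longrightarrow> Vrow l K \<theta>' i = rescaled_row l k \<theta> K i"
  shows "net \<mu> L l L \<theta>' x = net \<mu> L l L \<theta> x"
proof -
  \<comment> \<open>Layer \<open>k\<close> is exempt from the claim; \<open>k < L\<close> ensures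
    that the output layer is covered. Induction over all smaller layers is used because layer
    \<open>Suc k\<close> must reach below \<open>k\<close>.\<close>
  have "K \<noteq> k \<longrightarrow> (\<forall>x. net \<mu> L l K \<theta>' x = net \<mu> L l K \<theta> x)" if "1 \<le> K" "K \<le> L" for K
    using that
  proof (induction K rule: less_induct)
    case (less K)
    consider "K = 1" "K \<noteq> k" | "K = k" | "K = Suc k" | m where "K = Suc m" "m \<ge> 1" "m \<noteq> k" "K \<noteq> k"
      using less.prems by (cases K) force+
    then show ?case
    proof cases
      case 1
      then have "affine l 1 \<theta>' x = affine l 1 \<theta> x" for x
        using rows[of 1] less.prems assms(1) by (intro affine_cong) (auto simp: rescaled_row_def)
      with 1 show ?thesis by simp
    next
      case 2
      then show ?thesis by simp
    next
      case 3
      have below: "net \<mu> L l J \<theta>' x = net \<mu> L l J \<theta> x" if "J \<ge> 1" "J < k" for J x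
        using less.IH[of J] that 3 less.prems by simp
      have scaled: "net \<mu> L l k \<theta>' x i = row_scale l k \<theta> i * net \<mu> L l k \<theta> x i" if "i < l k" for i x
        using that assms rows[of k i] below
        by (intro net_row_scaled) (auto simp: rescaled_row_def rho_def row_scale_def Vnorm_def)
      have input: "layer_input \<mu> L l k \<theta>' x j = row_scale l k \<theta> j * layer_input \<mu> L l k \<theta> x j"
        if "j < l k" for j x
        using scaled[OF that] by (intro layer_input_cong row_scale_nonneg)
      \<comment> \<open>For a nonzero row the norm times \<open>row_scale\<close> is 1. For a zero
        row the original neuron is constantly 0, even after centering, so both sides vanish.\<close>
      have cancel: "Vnorm l k \<theta> j * layer_input \<mu> L l k \<theta>' x j = layer_input \<mu> L l k \<theta> x j"
        if "j < l k" for j x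
      proof (cases "Vnorm l k \<theta> j = 0")
        case True
        \<comment> \<open>A zero row is 0 times itself, so scaling with \<open>c = 0\<close> and
          equal parameters shows that the output is 0.\<close>
        have "Vrow l k \<theta> j = (\<lambda>i. 0 * Vrow l k \<theta> j i)" using Vnorm_eq_0[OF True] by auto
        then have "net \<mu> L l k \<theta> x j = 0 * net \<mu> L l k \<theta> x j" for x
          using assms(1) that by (intro net_row_scaled) auto
        then show ?thesis using True by (simp add: layer_input_eq_0)
      next
        case False
        then show ?thesis by (simp add: input[OF that] row_scale_def)
      qed
      have "affine l K \<theta>' (layer_input \<mu> L l k \<theta>' x) i = affine l K \<theta> (layer_input \<mu> L l k \<theta> x) i"
        for x i
      proof (cases "i < l K")
        case True
        have V: "Vrow l K \<theta>' i j = (if j < l k then Vnorm l k \<theta> j else 1) * Vrow l K \<theta> i j" for j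
          using rows[of K i] True 3 less.prems by (simp add: rescaled_row_def)
        have "Vrow l K \<theta>' i j * layer_input \<mu> L l k \<theta>' x j = Vrow l K \<theta> i j * layer_input \<mu> L l k \<theta> x j"
          if "j < l k" for j
          using that cancel[OF that, of x, symmetric] by (simp add: V)
        \<comment> \<open>The bias, at index \<open>l k\<close>, multiplies the constant 1 and no
          rescaled neuron, hence its factor 1.\<close>
        moreover have "Vrow l K \<theta>' i (l k) = Vrow l K \<theta> i (l k)" by (simp add: V)
        ultimately show ?thesis using True 3 by (simp add: affine_Vrow)
      qed (simp add: affine_def)
      then show ?thesis using 3 assms(1) by (auto simp: net_Suc)
    next
      case 4
      have "layer_input \<mu> L l m \<theta>' = layer_input \<mu> L l m \<theta>"
        using less.IH[of m] 4 less.prems by (intro ext) (simp add: layer_input_def)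
      moreover have "affine l K \<theta>' z = affine l K \<theta> z" for z
        using rows[of K] less.prems 4 by (intro affine_cong) (auto simp: rescaled_row_def)
      ultimately show ?thesis using 4 by (simp add: net_Suc)
    qed
  qed
  then show ?thesis using assms(1,2) by simp
qed

lemma net_Psi: "k < L \<Longrightarrow> net \<mu> L l L (Psi L l k \<theta>) x = net \<mu> L l L \<theta> x"
proof (induction k)
  case (Suc k)
  have "net \<mu> L l L (Psi L l (Suc k) \<theta>) x = net \<mu> L l L (Psi L l k \<theta>) x"
  proof (rule net_rescale_step[of "Suc k"])
    show "Vrow l K (Psi L l (Suc k) \<theta>) i = rescaled_row l (Suc k) (Psi L l k \<theta>) K i"
      if "K \<in> {1..L}" "i < l K" for K i
      using Vrow_Psi[of "Suc k" K L i l \<theta>] that unfolding rescaled_row_def diff_Suc_1 by simp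
  qed (use Suc in auto)
  with Suc show ?case by simp
qed simp

section \<open>Normalization of the hidden rows\<close>

lemma Vnorm_cong: "Vrow l k \<theta> i = Vrow l k \<theta>' i \<Longrightarrow> Vnorm l k \<theta> i = Vnorm l k \<theta>' i"
  by (simp add: Vnorm_def)

text \<open>Layers already normalized are not touched by later steps. Positivity of all hidden norms
  is carried along, because \<open>rho\<close> yields norm 1 only on a nonzero row.\<close>

lemma Vnorm_Psi:
  assumes pos: "\<And>K i. K \<in> {1..<L} \<Longrightarrow> i < l K \<Longrightarrow> Vnorm l K \<theta> i > 0"
    and "k < L" "K \<in> {1..<L}" "i < l K"
  shows "Vnorm l K (Psi L l k \<theta>) i > 0 \<and> (K \<le> k \<longrightarrow> Vnorm l K (Psi L l k \<theta>) i = 1)"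
  using assms(2-)
proof (induction k arbitrary: K i)
  case 0
  then show ?case using pos by simp
next
  case (Suc k)
  note V = Vrow_Psi[of "Suc k" K L i l \<theta>]
  have IH: "Vnorm l J (Psi L l k \<theta>) j > 0" "J \<le> k \<Longrightarrow> Vnorm l J (Psi L l k \<theta>) j = 1"
    if "J \<in> {1..<L}" "j < l J" for J j using Suc.IH[of J j] Suc.prems(1) that by auto
  consider "K = Suc k" | "K = Suc (Suc k)" | "K \<notin> {Suc k, Suc (Suc k)}" by auto
  then show ?case
  proof cases
    case 1
    then have "Vnorm l K (Psi L l (Suc k) \<theta>) i = 1"
      using V Suc.prems IH(1)[OF Suc.prems(2,3)] by (simp add: Vnorm_def enorm_rho)
    then show ?thesis by simp
  next
    case 2
    \<comment> \<open>The entries are multiplied by the positive norms of layer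
      \<open>Suc k\<close>, or by 1 for the bias, so a nonzero row stays nonzero.\<close>
    have "Vnorm l K (Psi L l (Suc k) \<theta>) i \<noteq> 0"
    proof
      assume 0: "Vnorm l K (Psi L l (Suc k) \<theta>) i = 0"
      have "Vrow l K (Psi L l k \<theta>) i j = 0" for j
        using Vnorm_eq_0[OF 0, of j] V 2 Suc.prems IH(1)[of "Suc k" j] by (auto split: if_splits)
      then have "Vnorm l K (Psi L l k \<theta>) i = 0" by (simp add: Vnorm_def L2_set_def)
      with IH(1)[OF Suc.prems(2,3)] show False by simp
    qed
    then show ?thesis using 2 Vnorm_nonneg[of l K "Psi L l (Suc k) \<theta>" i] by simp
  next
    case 3
    then have "Vnorm l K (Psi L l (Suc k) \<theta>) i = Vnorm l K (Psi L l k \<theta>) i"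
      using V Suc.prems by (intro Vnorm_cong) simp
    then show ?thesis using IH[OF Suc.prems(2,3)] 3 by auto
  qed
qed

section \<open>The submanifold of normalized parameters\<close>

lemma hidden_neurons_eq: "hidden_neurons L l = (SIGMA k:{1..L-1}. {..<l k})"
  by (auto simp: hidden_neurons_def)

text \<open>These blocks of coordinates carry the unit sphere conditions; the closed range includes
  the bias.\<close>

definition row_slots :: "(nat \<Rightarrow> nat) \<Rightarrow> nat \<times> nat \<Rightarrow> nat set" where
  "row_slots l = (\<lambda>(k, i). (\<lambda>j. slot l (k, i, j)) ` {..l (k - 1)})"

lemma Vnorm_eq_1_iff:
  assumes "k \<in> {1..L}" "i < l k"
  shows "Vnorm l k \<theta> i = 1 \<longleftrightarrow> (\<Sum>m\<in>row_slots l (k, i). (\<theta> m)\<^sup>2) = 1"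
proof -
  have "inj_on (\<lambda>j. slot l (k, i, j)) {..l (k - 1)}"
  proof (rule inj_onI)
    fix j j' assume j: "j \<in> {..l (k - 1)}" "j' \<in> {..l (k - 1)}" "slot l (k, i, j) = slot l (k, i, j')"
    have "(k, i, j) = (k, i, j')"
      by (rule inj_onD[OF slot_inj[of l L] j(3)]) (use assms j in \<open>simp_all add: slots_def\<close>)
    then show "j = j'" by simp
  qed
  then have "(\<Sum>m\<in>row_slots l (k, i). (\<theta> m)\<^sup>2) = (\<Sum>j\<le>l (k - 1). (Vrow l k \<theta> i j)\<^sup>2)"
    by (simp add: row_slots_def sum.reindex Vrow_slot)
  then show ?thesis
    by (simp add: Vnorm_def L2_set_def lessThan_Suc_atMost)
qed

text \<open>Injectivity of \<open>slot\<close> makes the rows disjoint blocks, so a product of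
  spheres is at hand, with one equation and hence one lost dimension per hidden neuron.\<close>

lemma normalized_params_submanifold:
  "smooth_submanifold (param_dim L l) (param_dim L l - (\<Sum>k=1..L-1. l k))
     {\<theta> \<in> Rn (param_dim L l). \<forall>(k, i) \<in> hidden_neurons L l. Vnorm l k \<theta> i = 1}"
proof -
  let ?H = "hidden_neurons L l"
  have H: "k \<in> {1..L}" "i < l k" if "(k, i) \<in> ?H" for k i
    using that by (auto simp: hidden_neurons_eq)
  have "smooth_submanifold (param_dim L l) (param_dim L l - card ?H)
      {\<theta> \<in> Rn (param_dim L l). \<forall>h\<in>?H. (\<Sum>m\<in>row_slots l h. (\<theta> m)\<^sup>2) = 1}"
  proof (rule sphere_product_submanifold)
    show "finite ?H" by (simp add: hidden_neurons_eq)
    show "row_slots l h \<subseteq> {..<param_dim L l}" if "h \<in> ?H" for h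
    proof -
      obtain k i where h: "h = (k, i)" by (cases h)
      have "(k, i, j) \<in> slots L l" if "j \<le> l (k - 1)" for j
        using H[of k i] \<open>h \<in> ?H\<close> that by (simp add: h slots_def)
      then show ?thesis
        using bij_betwE[OF slot_bij[of l L]] unfolding h row_slots_def by blast
    qed
    show "disjoint_family_on (row_slots l) ?H"
    proof (unfold disjoint_family_on_def, intro ballI impI)
      fix h h' assume h: "h \<in> ?H" "h' \<in> ?H" "h \<noteq> h'"
      obtain k i k' i' where eq: "h = (k, i)" "h' = (k', i')" by (cases h, cases h')
      have "slot l (k, i, j) \<noteq> slot l (k', i', j')" if "j \<le> l (k - 1)" "j' \<le> l (k' - 1)" for j j'
      proof
        assume "slot l (k, i, j) = slot l (k', i', j')"
        then have "(k, i, j) = (k', i', j')"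
          by (rule inj_onD[OF slot_inj[of l L]])
            (use H[of k i] H[of k' i'] h that in \<open>simp_all add: eq slots_def\<close>)
        with h(3) show False by (simp add: eq)
      qed
      then show "row_slots l h \<inter> row_slots l h' = {}"
        unfolding eq row_slots_def by blast
    qed
  qed
  moreover have "card ?H = (\<Sum>k=1..L-1. l k)" by (simp add: hidden_neurons_eq)
  moreover have "(\<forall>h\<in>?H. (\<Sum>m\<in>row_slots l h. (\<theta> m)\<^sup>2) = 1) \<longleftrightarrow>
      (\<forall>(k, i)\<in>?H. Vnorm l k \<theta> i = 1)" for \<theta>
  proof (intro ball_cong refl)
    fix h assume h: "h \<in> ?H"
    obtain k i where eq: "h = (k, i)" by (cases h)
    show "(\<Sum>m\<in>row_slots l h. (\<theta> m)\<^sup>2) = 1 \<longleftrightarrow> (case h of (k, i) \<Rightarrow> Vnorm l k \<theta> i = 1)"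
      using Vnorm_eq_1_iff[of k L i l \<theta>] H[of k i] h by (simp add: eq)
  qed
  ultimately show ?thesis by simp
qed

theorem proposition2p8:
  fixes a b :: real and L :: nat and l :: "nat \<Rightarrow> nat" and \<mu> :: "(nat \<Rightarrow> real) measure"
  assumes "a < b" and "L \<ge> 2" and "\<And>k. k \<le> L \<Longrightarrow> l k \<ge> 1"
    and "finite_measure \<mu>" and "sets \<mu> = sets (borel_cube a b (l 0))"
  shows
    "smooth_submanifold (param_dim L l) (param_dim L l - (\<Sum>k=1..L-1. l k))
       {\<theta> \<in> Rn (param_dim L l). \<forall>(k, i) \<in> hidden_neurons L l. Vnorm l k \<theta> i = 1} \<and>
     (\<forall>\<theta> \<in> Rn (param_dim L l). \<forall>x \<in> Rn (l 0).
        net \<mu> L l L \<theta> x = net \<mu> L l L (Psi L l (L - 1) \<theta>) x) \<and>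
     (\<forall>\<theta> \<in> {\<theta> \<in> Rn (param_dim L l).
              Min ((\<lambda>(k, i). Vnorm l k \<theta> i) ` hidden_neurons L l) > 0}.
        \<forall>(k, i) \<in> hidden_neurons L l. Vnorm l k (Psi L l (L - 1) \<theta>) i = 1)"
proof (intro conjI ballI normalized_params_submanifold)
  show "net \<mu> L l L \<theta> x = net \<mu> L l L (Psi L l (L - 1) \<theta>) x" for \<theta> x
    using net_Psi[of "L - 1" L \<mu> l \<theta> x] \<open>L \<ge> 2\<close> by simp
next
  fix \<theta> h
  assume \<theta>: "\<theta> \<in> {\<theta> \<in> Rn (param_dim L l).
      Min ((\<lambda>(k, i). Vnorm l k \<theta> i) ` hidden_neurons L l) > 0}"
    and h: "h \<in> hidden_neurons L l"
  have fin: "finite (hidden_neurons L l)" by (simp add: hidden_neurons_eq)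
  have "Vnorm l k \<theta> i > 0" if "k \<in> {1..<L}" "i < l k" for k i
  proof -
    have "(k, i) \<in> hidden_neurons L l" using that by (auto simp: hidden_neurons_eq)
    then have "Min ((\<lambda>(k, i). Vnorm l k \<theta> i) ` hidden_neurons L l) \<le> Vnorm l k \<theta> i"
      using fin by (intro Min_le) force+
    with \<theta> show ?thesis by simp
  qed
  \<comment> \<open>Every hidden layer has number at most \<open>L - 1\<close> and is therefore
    normalized after \<open>L - 1\<close> steps.\<close>
  then show "case h of (k, i) \<Rightarrow> Vnorm l k (Psi L l (L - 1) \<theta>) i = 1"
    using h Vnorm_Psi[of L l \<theta> "L - 1"] \<open>L \<ge> 2\<close> by (auto simp: hidden_neurons_eq)
qed

end
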